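(* For every integer $n\ge 2$, $$t_2^{\mathrm{match}}(n)\ge\frac18\left(\frac n4\right)^{3/5}.$$
   Context: An ordered matching of size $n$ is a graph on a linearly ordered vertex set of $2n$ vertices consisting of $n$ pairwise vertex-disjoint edges. Two ordered graphs on $m$ vertices $v_1<\cdots<v_m$ and $w_1<\cdots<w_m$ are order-isomorphic if for all $i<j$, $v_iv_j$ is an edge of the first if and only if $w_iw_j$ is an edge of the second. $2$-twins (twins) in an ordered matching $M$ are two disjoint, order-isomorphic sub-matchings $M_1,M_2$ of $M$ (sub-matchings inherit the vertex order of $M$); their size is $|M_1|=|M_2|$, the number of edges in just one of them. $t_2(M)$ denotes the maximum size of $2$-twins in $M$, and $t_2^{\mathrm{match}}(n)$ is the minimum of $t_2(M)$ over all ordered matchings $M$ of size $n$ on the vertex set $\{1,\dots,2n\}$. *)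

theory Defs
  imports Complex_Main
begin

definition ordered_matching :: "'a::linorder set \<Rightarrow> 'a set set \<Rightarrow> nat \<Rightarrow> bool" where
  "ordered_matching V M n \<longleftrightarrow>
     finite V \<and> card V = 2 * n \<and> finite M \<and> card M = n \<and>
     (\<forall>e\<in>M. e \<subseteq> V \<and> card e = 2) \<and> pairwise disjnt M"

definition order_isomorphic ::
    "'a::linorder set \<Rightarrow> 'a set set \<Rightarrow> 'b::linorder set \<Rightarrow> 'b set set \<Rightarrow> bool" where
  "order_isomorphic V E W F \<longleftrightarrow>
     finite V \<and> finite W \<and> card V = card W \<and>
     (\<forall>i j. i < j \<and> j < card V \<longrightarrow>
        ({sorted_list_of_set V ! i, sorted_list_of_set V ! j} \<in> E \<longleftrightarrow>
         {sorted_list_of_set W ! i, sorted_list_of_set W ! j} \<in> F))"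

(* A sub-matching is a subset M1 of the edges on the vertex set \<Union>M1 of its endpoints;
   in a matching, edge-disjoint sub-matchings are also vertex-disjoint. *)
definition twins :: "'a::linorder set set \<Rightarrow> 'a set set \<Rightarrow> 'a set set \<Rightarrow> bool" where
  "twins M M1 M2 \<longleftrightarrow>
     M1 \<subseteq> M \<and> M2 \<subseteq> M \<and> M1 \<inter> M2 = {} \<and>
     order_isomorphic (\<Union>M1) M1 (\<Union>M2) M2"

definition t2 :: "'a::linorder set set \<Rightarrow> nat" where
  "t2 M = Max {card M1 | M1 M2. twins M M1 M2}"

definition t2_match :: "nat \<Rightarrow> nat" where
  "t2_match n = Min {t2 M | M. ordered_matching {1..2 * n} M n}"

(* The sets in the two extrema above are finite and nonempty. *)

lemma twin_sizes_finite: "finite M \<Longrightarrow> finite {card M1 | M1 M2. twins M M1 M2}"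
  by (rule finite_subset[of _ "card ` Pow M"]) (auto simp: twins_def)

lemma twin_sizes_nonempty: "{card M1 | M1 M2. twins M M1 M2} \<noteq> {}"
proof -
  have "twins M {} {}" by (simp add: twins_def order_isomorphic_def)
  then show ?thesis by blast
qed

lemma t2_values_finite: "finite {t2 M | M. ordered_matching {1..2 * n} M n}"
  by (rule finite_subset[of _ "t2 ` Pow (Pow {1..2 * n})"]) (auto simp: ordered_matching_def)

lemma t2_values_nonempty: "{t2 M | M. ordered_matching {1..2 * n} M n} \<noteq> {}"
proof -
  let ?M = "(\<lambda>i. {i, i + n}) ` {1..n}"
  have "inj_on (\<lambda>i. {i, i + n}) {1..n}"
    by (auto simp: inj_on_def doubleton_eq_iff)
  then have "ordered_matching {1..2 * n} ?M n"
    by (auto simp: ordered_matching_def card_image pairwise_def disjnt_def)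
  then show ?thesis by blast
qed

end

theory Submission
  imports Defs "HOL-Library.FuncSet"
begin

text \<open>
Edges crossing a common point form a permutation (order of left endpoints against order of right
endpoints), and a matching with fewer than n/4 edges across a suitable point splits into two
separated matchings of size at least n/3, whose twins can be concatenated. So it suffices
to find twins of length N^(3/5) / 8 in permutations of length N, which is the theorem of Bukh and
Rudenko.

For this the points are cut by a grid into about N^(3/5) columns and N^(2/5) bands, with a few
points per cell, grouped into triples. Among three permutations of a k-element set some two have a common
subsequence of length at least the cube root of k. Applied to the triples of a band, it gives about
N^(1/5) pairs of points such that the first and the second points are ordered alike. Using
every column for one band only makes the pairs of different bands compatible as well.
\<close>

section \<open>Chains in families of orders\<close>

text \<open>A pigeonhole argument in the manner of Erdos and Szekeres. Three orders on triples give
  a cube root below, two orders on points give a square root.\<close>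

lemma exists_large_chain:
  fixes R :: "'i \<Rightarrow> 'a rel"
  assumes I: "finite I" "I \<noteq> {}" and A: "finite A"
    and tr: "\<And>i. i \<in> I \<Longrightarrow> trans (R i)"
    and ir: "\<And>i. i \<in> I \<Longrightarrow> irrefl (R i)"
    and tot: "\<And>x y. x \<in> A \<Longrightarrow> y \<in> A \<Longrightarrow> x \<noteq> y \<Longrightarrow> \<exists>i\<in>I. (x, y) \<in> R i \<or> (y, x) \<in> R i"
  shows "\<exists>i\<in>I. \<exists>C\<subseteq>A. total_on C (R i) \<and> card A \<le> card C ^ card I"
proof -
  define chains where "chains i = {C. C \<subseteq> A \<and> total_on C (R i)}" for i
  define S where "S = (\<Union>i\<in>I. card ` chains i)"
  define m where "m = Max S"
  have fin_chains: "finite (chains i)" for i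
    unfolding chains_def using A by simp
  have finS: "finite S"
    unfolding S_def using I fin_chains by blast
  have "{} \<in> chains i" for i
    by (simp add: chains_def)
  then have "S \<noteq> {}"
    unfolding S_def using I(2) by blast
  then have "m \<in> S"
    unfolding m_def using finS by simp
  then obtain i C where iC: "i \<in> I" "C \<in> chains i" "m = card C"
    by (auto simp: S_def)
  txt \<open>Label each element by the lengths, one per order, of the longest chains ending at it;
    comparability in some order makes the labels distinct.\<close>
  define below where "below i x = {C \<in> chains i. x \<in> C \<and> (\<forall>y\<in>C. y \<noteq> x \<longrightarrow> (y, x) \<in> R i)}" for i x
  define ht where "ht i x = Max (card ` below i x)" for i x
  have fin_below: "finite (below i x)" for i x
    unfolding below_def using fin_chains by simp
  have sing: "{x} \<in> below i x" if "x \<in> A" for i x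
    using that by (auto simp: below_def chains_def)
  have ht_bounds: "ht i x \<in> {1..m}" if "i \<in> I" "x \<in> A" for i x
  proof -
    have "1 \<le> ht i x"
      unfolding ht_def using fin_below sing[OF \<open>x \<in> A\<close>] by (intro Max_ge) force+
    moreover have "ht i x \<in> card ` below i x"
      unfolding ht_def using fin_below sing[OF \<open>x \<in> A\<close>] by (intro Max_in) auto
    then have "ht i x \<in> S"
      using \<open>i \<in> I\<close> by (auto simp: S_def below_def)
    then have "ht i x \<le> m"
      unfolding m_def using finS by simp
    ultimately show ?thesis by simp
  qed
  have ht_less: "ht i x < ht i y" if "i \<in> I" "x \<in> A" "y \<in> A" "(x, y) \<in> R i" for i x y
  proof -
    have "ht i x \<in> card ` below i x"
      unfolding ht_def using fin_below sing[OF \<open>x \<in> A\<close>] by (intro Max_in) auto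
    then obtain D where D: "D \<in> below i x" "ht i x = card D"
      by auto
    have lt: "(z, y) \<in> R i" if "z \<in> D" for z
      using that D \<open>(x, y) \<in> R i\<close> tr[OF \<open>i \<in> I\<close>] by (auto simp: below_def dest: transD)
    have "y \<notin> D"
      using lt ir[OF \<open>i \<in> I\<close>] by (auto simp: irrefl_def)
    moreover have "finite D"
      using D A by (auto simp: below_def chains_def dest: finite_subset)
    ultimately have card: "card (insert y D) = Suc (ht i x)"
      using D by simp
    have "insert y D \<in> below i y"
      using D lt \<open>y \<in> A\<close> by (auto simp: below_def chains_def total_on_def)
    then have "card (insert y D) \<le> ht i y"
      unfolding ht_def using fin_below by (intro Max_ge) auto
    then show ?thesis
      using card by simp
  qed
  define lab where "lab x = (\<lambda>i\<in>I. ht i x)" for x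
  have "inj_on lab A"
  proof (rule inj_onI, rule ccontr)
    fix x y assume xy: "x \<in> A" "y \<in> A" "lab x = lab y" "x \<noteq> y"
    then obtain i where i: "i \<in> I" "(x, y) \<in> R i \<or> (y, x) \<in> R i"
      using tot by blast
    have "ht i x = ht i y"
      using xy(3) i(1) unfolding lab_def by (metis restrict_apply)
    then show False
      using i ht_less xy(1,2) by fastforce
  qed
  moreover have "lab ` A \<subseteq> I \<rightarrow>\<^sub>E {1..m}"
    using ht_bounds by (auto simp: lab_def simp del: atLeastAtMost_iff)
  moreover have "finite (I \<rightarrow>\<^sub>E {1..m})"
    using I by (intro finite_PiE) auto
  ultimately have "card A \<le> card (I \<rightarrow>\<^sub>E {1..m})"
    by (rule card_inj_on_le)
  also have "\<dots> = m ^ card I"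
    using I by (simp add: card_PiE)
  finally show ?thesis
    using iC by (auto simp: chains_def)
qed

section \<open>Comonotone pairs, ranks and blocks\<close>

text \<open>\<open>K\<close> pairs each element of one twin with its partner in the other. Since
  \<open>f\<close> and \<open>g\<close> range over \<open>F\<close> independently,
  \<open>F = {l, r}\<close> also controls comparisons of left with right endpoints. The two
  coordinates of a permutation are never compared with each other, hence the separate uses with
  \<open>{u}\<close> and \<open>{v}\<close>.\<close>

definition comonotone :: "('a \<Rightarrow> 'b::linorder) set \<Rightarrow> ('a \<times> 'a) set \<Rightarrow> bool" where
  "comonotone F K \<longleftrightarrow> (\<forall>(a, a') \<in> K. \<forall>(b, b') \<in> K. \<forall>f\<in>F. \<forall>g\<in>F. f a < g b \<longleftrightarrow> f a' < g b')"

lemma comonotoneI: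
  assumes "\<And>a a' b b' f g. (a, a') \<in> K \<Longrightarrow> (b, b') \<in> K \<Longrightarrow> f \<in> F \<Longrightarrow> g \<in> F \<Longrightarrow> f a < g b \<longleftrightarrow> f a' < g b'"
  shows "comonotone F K"
  unfolding comonotone_def using assms by blast

lemma comonotoneD:
  assumes "comonotone F K" "(a, a') \<in> K" "(b, b') \<in> K" "f \<in> F" "g \<in> F"
  shows "f a < g b \<longleftrightarrow> f a' < g b'"
  using assms unfolding comonotone_def by blast

text \<open>Only comparisons across \<open>K\<close> and \<open>L\<close> remain to be checked. They
  are asked for in both directions because \<open>f a < g b\<close> may also fail by
  equality.\<close>

lemma comonotone_Un:
  assumes "comonotone F K" "comonotone F L"
    and "\<And>a a' b b' f g. (a, a') \<in> K \<Longrightarrow> (b, b') \<in> L \<Longrightarrow> f \<in> F \<Longrightarrow> g \<in> F \<Longrightarrow> f a < g b \<longleftrightarrow> f a' < g b'"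
    and "\<And>a a' b b' f g. (a, a') \<in> K \<Longrightarrow> (b, b') \<in> L \<Longrightarrow> f \<in> F \<Longrightarrow> g \<in> F \<Longrightarrow> g b < f a \<longleftrightarrow> g b' < f a'"
  shows "comonotone F (K \<union> L)"
proof (rule comonotoneI)
  fix a a' b b' f g
  assume ab: "(a, a') \<in> K \<union> L" "(b, b') \<in> K \<union> L" and fg: "f \<in> F" "g \<in> F"
  from ab consider "(a, a') \<in> K" "(b, b') \<in> K" | "(a, a') \<in> L" "(b, b') \<in> L"
    | "(a, a') \<in> K" "(b, b') \<in> L" | "(a, a') \<in> L" "(b, b') \<in> K"
    by blast
  then show "f a < g b \<longleftrightarrow> f a' < g b'"
  proof cases
    case 1
    then show ?thesis using comonotoneD[OF assms(1)] fg by blast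
  next
    case 2
    then show ?thesis using comonotoneD[OF assms(2)] fg by blast
  next
    case 3
    then show ?thesis using assms(3) fg by blast
  next
    case 4
    then show ?thesis using assms(4)[OF 4(2,1)] fg by blast
  qed
qed

text \<open>Ranks turn injective coordinates in any linear order into bijections onto
  \<open>{..<card A}\<close>, which a grid can cut by integer division.\<close>

definition rank :: "'a set \<Rightarrow> ('a \<Rightarrow> 'b::linorder) \<Rightarrow> 'a \<Rightarrow> nat" where
  "rank A f a = card {b \<in> A. f b < f a}"

lemma rank_less_iff:
  assumes "finite A" "a \<in> A" "b \<in> A"
  shows "rank A f a < rank A f b \<longleftrightarrow> f a < f b"
proof -
  have less: "rank A f a < rank A f b" if "f a < f b" "a \<in> A" for a b
  proof -
    have "{c \<in> A. f c < f a} \<subset> {c \<in> A. f c < f b}"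
      using that by (auto dest: less_trans)
    then show ?thesis
      unfolding rank_def using assms(1) by (intro psubset_card_mono) auto
  qed
  have "rank A f b \<le> rank A f a" if "\<not> f a < f b"
    unfolding rank_def using that assms(1) by (intro card_mono) auto
  then show ?thesis
    using less[of a b] assms by fastforce
qed

lemma bij_betw_rank:
  assumes "finite A" "inj_on f A"
  shows "bij_betw (rank A f) A {..<card A}"
proof -
  have "inj_on (rank A f) A"
  proof (rule inj_onI)
    fix a b assume "a \<in> A" "b \<in> A" "rank A f a = rank A f b"
    then have "\<not> f a < f b" "\<not> f b < f a"
      using rank_less_iff[OF assms(1)] by (metis less_irrefl)+
    then show "a = b"
      using \<open>a \<in> A\<close> \<open>b \<in> A\<close> assms(2) by (auto simp: inj_on_def)
  qed
  moreover have "rank A f ` A \<subseteq> {..<card A}"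
  proof clarsimp
    fix a assume "a \<in> A"
    then have "{b \<in> A. f b < f a} \<subset> A" by auto
    then show "rank A f a < card A"
      unfolding rank_def using assms(1) by (rule psubset_card_mono[rotated])
  qed
  ultimately show ?thesis
    using assms(1) by (simp add: bij_betw_def card_subset_eq card_image)
qed

lemma initial_segment:
  fixes f :: "'a \<Rightarrow> 'b::linorder"
  assumes "finite A" "inj_on f A" "k \<le> card A"
  obtains B where "B \<subseteq> A" "card B = k" "\<And>b a. b \<in> B \<Longrightarrow> a \<in> A - B \<Longrightarrow> f b < f a"
proof
  let ?B = "{a \<in> A. rank A f a < k}"
  have bij: "bij_betw (rank A f) A {..<card A}"
    using assms by (rule_tac bij_betw_rank)
  have im: "rank A f ` ?B = {..<k}"
  proof -
    have "rank A f ` ?B = rank A f ` A \<inter> {..<k}" by auto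
    also have "rank A f ` A = {..<card A}" using bij by (simp add: bij_betw_def)
    finally show ?thesis using assms(3) by auto
  qed
  have "inj_on (rank A f) ?B"
    using bij by (auto simp: bij_betw_def inj_on_def)
  then show "card ?B = k"
    using im by (metis card_image card_lessThan)
  show "f b < f a" if "b \<in> ?B" "a \<in> A - ?B" for a b
  proof -
    have "rank A f b < rank A f a" using that by auto
    then show ?thesis using that rank_less_iff[OF assms(1)] by blast
  qed
qed auto

text \<open>The \<open>k\<close> smallest elements are cut off until fewer than \<open>k\<close> are
  left. Blocks are lists so that their entries can be addressed by position; the order inside a
  block is arbitrary, only the order between blocks is controlled.\<close>

lemma consecutive_blocks:
  fixes f :: "'a \<Rightarrow> 'b::linorder"
  assumes "finite Z" "inj_on f Z" and k: "0 < k"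
  shows "\<exists>T. finite T \<and> card Z < k * card T + k \<and>
    (\<forall>t\<in>T. length t = k \<and> distinct t \<and> set t \<subseteq> Z) \<and>
    (\<forall>t\<in>T. \<forall>t'\<in>T. t \<noteq> t' \<longrightarrow> (\<forall>a\<in>set t. \<forall>b\<in>set t'. f a < f b) \<or> (\<forall>a\<in>set t. \<forall>b\<in>set t'. f b < f a))"
  using assms(1,2)
proof (induction "card Z" arbitrary: Z rule: less_induct)
  case less
  show ?case
  proof (cases "card Z < k")
    case True
    then show ?thesis by (intro exI[of _ "{}"]) auto
  next
    case False
    then have "k \<le> card Z" by simp
    then obtain B where B: "B \<subseteq> Z" "card B = k" "\<And>b a. b \<in> B \<Longrightarrow> a \<in> Z - B \<Longrightarrow> f b < f a"
      using initial_segment[OF less.prems] by metis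
    have "finite B" using B less.prems finite_subset by blast
    then obtain t0 where t0: "set t0 = B" "distinct t0"
      using finite_distinct_list by blast
    then have len: "length t0 = k" using B distinct_card by metis
    have cZ: "card (Z - B) = card Z - k"
      using B \<open>finite B\<close> by (simp add: card_Diff_subset)
    then have "card (Z - B) < card Z" using \<open>k \<le> card Z\<close> k by simp
    moreover have "finite (Z - B)" "inj_on f (Z - B)"
      using less.prems by (auto intro: inj_on_subset)
    ultimately obtain T where T: "finite T" "card (Z - B) < k * card T + k"
      "\<forall>t\<in>T. length t = k \<and> distinct t \<and> set t \<subseteq> Z - B"
      "\<forall>t\<in>T. \<forall>t'\<in>T. t \<noteq> t' \<longrightarrow> (\<forall>a\<in>set t. \<forall>b\<in>set t'. f a < f b) \<or> (\<forall>a\<in>set t. \<forall>b\<in>set t'. f b < f a)"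
      using less.hyps[of "Z - B"] by blast
    have "t0 \<notin> T"
    proof
      assume "t0 \<in> T"
      then have "B \<subseteq> Z - B" using T(3) t0(1) by blast
      then have "B = {}" by blast
      then show False using B(2) k by simp
    qed
    then have "card Z < k * card (insert t0 T) + k"
      using T(1,2) cZ by simp
    moreover have sep: "f a < f b" if "t \<in> T" "a \<in> set t0" "b \<in> set t" for t a b
      using that T(3) t0 B(3) by blast
    have "\<forall>t\<in>insert t0 T. \<forall>t'\<in>insert t0 T. t \<noteq> t' \<longrightarrow>
      (\<forall>a\<in>set t. \<forall>b\<in>set t'. f a < f b) \<or> (\<forall>a\<in>set t. \<forall>b\<in>set t'. f b < f a)"
      using T(4) sep by (metis insert_iff)
    ultimately show ?thesis
      using T(1,3) len t0 B(1) by (intro exI[of _ "insert t0 T"]) auto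
  qed
qed

section \<open>Triples and the greedy choice of pairs\<close>

lemma three_card_triples_le:
  assumes "finite Z" "finite T"
    and "\<And>t. t \<in> T \<Longrightarrow> length t = 3 \<and> distinct t \<and> set t \<subseteq> Z"
    and "\<And>t t'. t \<in> T \<Longrightarrow> t' \<in> T \<Longrightarrow> t \<noteq> t' \<Longrightarrow> set t \<inter> set t' = {}"
  shows "3 * card T \<le> card Z"
proof -
  have "card (\<Union>t\<in>T. set t) = (\<Sum>t\<in>T. card (set t))"
    using assms by (intro card_UN_disjoint) auto
  also have "\<dots> = (\<Sum>t\<in>T. 3)"
    using assms(3) by (intro sum.cong) (auto simp: distinct_card)
  finally have "3 * card T = card (\<Union>t\<in>T. set t)" by simp
  also have "\<dots> \<le> card Z"
    using assms by (intro card_mono) auto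
  finally show ?thesis .
qed

text \<open>Two of the three permutations induced by the coordinates agree on any given pair of triples;
  the order indexed by i below records agreement of the two coordinates other than i.\<close>

lemma agreeing_projections:
  fixes v :: "'a \<Rightarrow> 'b::linorder"
  assumes T: "finite T" "\<And>t. t \<in> T \<Longrightarrow> length t = 3"
    and disj: "\<And>t t'. t \<in> T \<Longrightarrow> t' \<in> T \<Longrightarrow> t \<noteq> t' \<Longrightarrow> set t \<inter> set t' = {}"
    and inj: "inj_on v (\<Union>t\<in>T. set t)"
  shows "\<exists>S\<subseteq>T. \<exists>j<3. \<exists>k<3. j \<noteq> k \<and> card T \<le> card S ^ 3 \<and>
    (\<forall>t\<in>S. \<forall>t'\<in>S. v (t ! j) < v (t' ! j) \<longleftrightarrow> v (t ! k) < v (t' ! k))"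
proof -
  define R where "R i = {(t, t'). \<forall>j<3. j \<noteq> i \<longrightarrow> v (t ! j) < v (t' ! j)}" for i :: nat
  have other: "\<exists>j k. j < 3 \<and> k < 3 \<and> j \<noteq> k \<and> j \<noteq> i \<and> k \<noteq> i" if i: "i < 3" for i :: nat
  proof -
    consider "i = 0" | "i = 1" | "i = 2" using i by linarith
    then show ?thesis
    proof cases
      case 1
      show ?thesis unfolding 1 by (rule exI[of _ 1], rule exI[of _ 2]) simp
    next
      case 2
      show ?thesis unfolding 2 by (rule exI[of _ 0], rule exI[of _ 2]) simp
    next
      case 3
      show ?thesis unfolding 3 by (rule exI[of _ 0], rule exI[of _ 1]) simp
    qed
  qed
  have tr: "trans (R i)" for i
    unfolding R_def by (rule transI) (auto intro: less_trans)
  have ir: "irrefl (R i)" if "i \<in> {..<3}" for i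
    using other[of i] that by (auto simp: irrefl_def R_def)
  \<comment> \<open>Of three strict comparisons two go the same way; the index left over serves as
    \<open>i\<close>.\<close>
  have tot: "\<exists>i\<in>{..<3}. (x, y) \<in> R i \<or> (y, x) \<in> R i" if xy: "x \<in> T" "y \<in> T" "x \<noteq> y" for x y
  proof -
    have ne: "v (x ! j) < v (y ! j) \<or> v (y ! j) < v (x ! j)" if "j < 3" for j
    proof -
      have "x ! j \<in> set x" "y ! j \<in> set y" using that T(2) xy by auto
      then have "x ! j \<noteq> y ! j" using disj[OF xy] by (metis disjoint_iff)
      then have "v (x ! j) \<noteq> v (y ! j)"
        using \<open>x ! j \<in> set x\<close> \<open>y ! j \<in> set y\<close> xy inj_onD[OF inj, of "x ! j" "y ! j"] by (metis UN_I)
      then show ?thesis by (simp add: neq_iff)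
    qed
    have R: "(s, t) \<in> R i \<longleftrightarrow> (0 \<noteq> i \<longrightarrow> v (s ! 0) < v (t ! 0)) \<and> (1 \<noteq> i \<longrightarrow> v (s ! 1) < v (t ! 1))
      \<and> (2 \<noteq> i \<longrightarrow> v (s ! 2) < v (t ! 2))" for s t i
    proof -
      have "(\<forall>j<3. P j) \<longleftrightarrow> P 0 \<and> P 1 \<and> P 2" for P :: "nat \<Rightarrow> bool"
        by (auto simp: numeral_3_eq_3 numeral_2_eq_2 less_Suc_eq)
      then show ?thesis unfolding R_def by simp
    qed
    have "(\<exists>i\<in>{..<3}. P i) \<longleftrightarrow> P 0 \<or> P 1 \<or> P 2" for P :: "nat \<Rightarrow> bool"
      by (auto simp: numeral_3_eq_3 numeral_2_eq_2 less_Suc_eq)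
    then show ?thesis
      unfolding R using ne[of 0] ne[of 1] ne[of 2] by auto
  qed
  obtain i S where iS: "i < 3" "S \<subseteq> T" "total_on S (R i)" "card T \<le> card S ^ 3"
  proof -
    have "{..<3::nat} \<noteq> {}" by (simp add: lessThan_empty_iff)
    then have "\<exists>i\<in>{..<3}. \<exists>C\<subseteq>T. total_on C (R i) \<and> card T \<le> card C ^ card {..<3::nat}"
      using T(1) tr ir tot by (intro exists_large_chain) auto
    then show ?thesis using that by auto
  qed
  obtain j k where jk: "j < 3" "k < 3" "j \<noteq> k" "j \<noteq> i" "k \<noteq> i"
    using other[OF iS(1)] by blast
  have "v (t ! j) < v (t' ! j) \<longleftrightarrow> v (t ! k) < v (t' ! k)" if "t \<in> S" "t' \<in> S" for t t'
  proof (cases "t = t'")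
    case False
    then have "(t, t') \<in> R i \<or> (t', t) \<in> R i"
      using iS(3) that by (auto simp: total_on_def)
    then show ?thesis
      unfolding R_def using jk by (auto dest: less_asym)
  qed simp
  then show ?thesis
    using iS jk by blast
qed

text \<open>The bands are treated one after another. Each column serves a single band, so pairs from different
  bands lie in different columns and compare in the same way as the cells that contain them.
  The last conjunct says that the triples not yet paid for lie in columns already in use.\<close>

lemma greedy_pairs:
  fixes u :: "'a \<Rightarrow> 'b::linorder" and v :: "'a \<Rightarrow> 'c::linorder" and col band :: "'a \<Rightarrow> nat" and q :: real
  assumes A: "finite A" "inj_on v A"
    and col: "\<And>a b. a \<in> A \<Longrightarrow> b \<in> A \<Longrightarrow> col a < col b \<Longrightarrow> u a < u b"
    and band: "\<And>a b. a \<in> A \<Longrightarrow> b \<in> A \<Longrightarrow> band a < band b \<Longrightarrow> v a < v b"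
    and T: "finite T" "\<And>t. t \<in> T \<Longrightarrow> length t = 3 \<and> distinct t \<and> set t \<subseteq> A"
    and cell: "\<And>t a b. t \<in> T \<Longrightarrow> a \<in> set t \<Longrightarrow> b \<in> set t \<Longrightarrow> col a = col b \<and> band a = band b"
    and sep: "\<And>t t'. t \<in> T \<Longrightarrow> t' \<in> T \<Longrightarrow> t \<noteq> t' \<Longrightarrow> col (hd t) = col (hd t') \<Longrightarrow> band (hd t) = band (hd t') \<Longrightarrow>
      (\<forall>a\<in>set t. \<forall>b\<in>set t'. u a < u b) \<or> (\<forall>a\<in>set t. \<forall>b\<in>set t'. u b < u a)"
    and q: "\<And>j l N. N \<le> card {t \<in> T. band (hd t) = j} \<Longrightarrow> N \<le> l ^ 3 \<Longrightarrow> real N \<le> real l * q"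
  shows "\<exists>K\<subseteq>A \<times> A. (\<forall>(a, a')\<in>K. band a < j \<and> col a = col a' \<and> band a = band a') \<and>
    comonotone {u} K \<and> comonotone {v} K \<and> fst ` K \<inter> snd ` K = {} \<and>
    real (card {t \<in> T. band (hd t) < j \<and> col (hd t) \<notin> col ` fst ` K}) \<le> real (card K) * q"
proof (induction j)
  case 0
  show ?case by (rule exI[of _ "{}"]) (simp add: comonotone_def)
next
  case (Suc j)
  then obtain K where K': "K \<subseteq> A \<times> A" "\<forall>(a, a')\<in>K. band a < j \<and> col a = col a' \<and> band a = band a'"
    "comonotone {u} K" "comonotone {v} K" "fst ` K \<inter> snd ` K = {}"
    "real (card {t \<in> T. band (hd t) < j \<and> col (hd t) \<notin> col ` fst ` K}) \<le> real (card K) * q"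
    by (elim exE conjE)
  have "band a < j \<and> col a = col a' \<and> band a = band a'" if "(a, a') \<in> K" for a a'
    using K'(2) that by blast
  note K = K'(1) this K'(3-6)
  \<comment> \<open>The triples of band \<open>j\<close> in columns that are still free. Only these
    may contribute new pairs.\<close>
  define T' where "T' = {t \<in> T. band (hd t) = j \<and> col (hd t) \<notin> col ` fst ` K}"
  have T'T: "t \<in> T" if "t \<in> T'" for t using that by (simp add: T'_def)
  have nthA: "t ! i \<in> set t" "t ! i \<in> A" "col (t ! i) = col (hd t)" "band (t ! i) = band (hd t)"
    if "t \<in> T" "i < 3" for t i
  proof -
    show "t ! i \<in> set t" using that T(2) by simp
    then show "t ! i \<in> A" using that T(2) by blast
    have "t \<noteq> []" using that T(2) by force
    then have "hd t \<in> set t" by simp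
    then show "col (t ! i) = col (hd t)" "band (t ! i) = band (hd t)"
      using cell[OF \<open>t \<in> T\<close> \<open>t ! i \<in> set t\<close>] by blast+
  qed
  \<comment> \<open>In \<open>u\<close>, any two of these triples are separated as a whole: by
    \<open>sep\<close> inside a cell, by their columns otherwise. So every choice of positions in
    the triples gives the same \<open>u\<close>-order, and only the \<open>v\<close>-order needs
    \<open>agreeing_projections\<close>.\<close>
  have sep': "(\<forall>a\<in>set t. \<forall>b\<in>set t'. u a < u b) \<or> (\<forall>a\<in>set t. \<forall>b\<in>set t'. u b < u a)"
    if "t \<in> T'" "t' \<in> T'" "t \<noteq> t'" for t t'
  proof (cases "col (hd t) = col (hd t')")
    case True
    then show ?thesis using sep that by (simp add: T'_def)
  next
    case False
    have "\<forall>a\<in>set s. \<forall>b\<in>set s'. u a < u b" if "s \<in> T'" "s' \<in> T'" "col (hd s) < col (hd s')" for s s'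
    proof (intro ballI)
      fix a b assume ab: "a \<in> set s" "b \<in> set s'"
      have ne: "s \<noteq> []" "s' \<noteq> []" using ab by auto
      have "col a = col (hd s)" "col b = col (hd s')"
        using cell[OF T'T[OF that(1)] ab(1)] cell[OF T'T[OF that(2)] ab(2)] ne by auto
      then show "u a < u b"
        using col[of a b] ab that T(2)[OF T'T[OF that(1)]] T(2)[OF T'T[OF that(2)]] by auto
    qed
    then show ?thesis
      using False that by (metis linorder_neqE_nat)
  qed
  have disj: "set t \<inter> set t' = {}" if "t \<in> T'" "t' \<in> T'" "t \<noteq> t'" for t t'
    using sep'[OF that] by (meson disjoint_iff less_irrefl)
  have "inj_on v (\<Union>t\<in>T'. set t)"
    using A(2) by (rule inj_on_subset) (use T(2) T'T in blast)
  moreover have finT': "finite T'" using T(1) by (simp add: T'_def)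
  ultimately obtain S i k where S: "S \<subseteq> T'" "i < 3" "k < 3" "i \<noteq> k" "card T' \<le> card S ^ 3"
    "\<And>t t'. t \<in> S \<Longrightarrow> t' \<in> S \<Longrightarrow> v (t ! i) < v (t' ! i) \<longleftrightarrow> v (t ! k) < v (t' ! k)"
    using agreeing_projections[of T' v] disj T(2) T'T by (metis (no_types, lifting))
  \<comment> \<open>Each selected triple contributes its \<open>i\<close>-th and \<open>k\<close>-th
    point as partners, where positions \<open>i\<close> and \<open>k\<close> have the same
    \<open>v\<close>-order throughout \<open>S\<close>.\<close>
  define L where "L = (\<lambda>t. (t ! i, t ! k)) ` S"
  have ST: "t \<in> T" if "t \<in> S" for t using that S(1) T'T by blast
  have ne: "t ! i' \<noteq> t' ! k'" if "t \<in> S" "t' \<in> S" "t \<noteq> t' \<or> i' \<noteq> k'" "i' < 3" "k' < 3" for t t' i' k'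
  proof (cases "t = t'")
    case True
    then show ?thesis using that T(2)[OF ST[OF that(1)]] by (simp add: nth_eq_iff_index_eq)
  next
    case False
    then have "set t \<inter> set t' = {}" using disj that S(1) by blast
    then show ?thesis using nthA(1)[OF ST[OF that(1)] that(4)] nthA(1)[OF ST[OF that(2)] that(5)] by force
  qed
  have "inj_on (\<lambda>t. (t ! i, t ! k)) S"
    using ne S(2) by (intro inj_onI) (metis Pair_inject)
  then have cardL: "card L = card S" by (simp add: L_def card_image)
  have LA: "L \<subseteq> A \<times> A"
    using nthA(2) ST S(2,3) by (auto simp: L_def)
  have L: "band a = j \<and> band a' = j \<and> col a = col a' \<and> col a \<notin> col ` fst ` K" if aa': "(a, a') \<in> L" for a a'
  proof -
    obtain t where t: "t \<in> S" "a = t ! i" "a' = t ! k" using aa' by (auto simp: L_def)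
    then have "t \<in> T'" using S(1) by blast
    then have "band (hd t) = j" "col (hd t) \<notin> col ` fst ` K" by (simp_all add: T'_def)
    then show ?thesis
      using nthA(3,4)[OF ST[OF t(1)] S(2)] nthA(3,4)[OF ST[OF t(1)] S(3)] t(2,3) by simp
  qed
  have L_u: "u a < u b \<longleftrightarrow> u a' < u b'" if pairs: "(a, a') \<in> L" "(b, b') \<in> L" for a a' b b'
  proof -
    obtain t t' where t: "t \<in> S" "t' \<in> S" "a = t ! i" "a' = t ! k" "b = t' ! i" "b' = t' ! k"
      using pairs by (auto simp: L_def)
    have mem: "t ! i \<in> set t" "t ! k \<in> set t" "t' ! i \<in> set t'" "t' ! k \<in> set t'"
      using nthA(1)[OF ST] t(1,2) S(2,3) by blast+
    show ?thesis
    proof (cases "t = t'")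
      case True
      then show ?thesis using t by simp
    next
      case False
      have "t \<in> T'" "t' \<in> T'" using t(1,2) S(1) by blast+
      from sep'[OF this False] show ?thesis
        unfolding t(3-6) using mem by (metis less_asym)
    qed
  qed
  have L_v: "v a < v b \<longleftrightarrow> v a' < v b'" if "(a, a') \<in> L" "(b, b') \<in> L" for a a' b b'
    using that S(6) by (auto simp: L_def)
  have "fst ` L \<inter> snd ` L = {}"
    using ne S(2-4) by (auto simp: L_def)
  have finK: "finite K" "finite L" using K(1) LA A(1) by (auto intro: finite_subset)
  \<comment> \<open>Old and new pairs occupy different columns, and partners share a column, so both
    comparisons reduce to comparing the two columns.\<close>
  have KL_col: "u a < u b \<longleftrightarrow> u a' < u b'" "u b < u a \<longleftrightarrow> u b' < u a'" 
    if "(a, a') \<in> K" "(b, b') \<in> L" for a a' b b'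
  proof -
    have "col a \<in> col ` fst ` K" using that(1) by (metis fst_conv image_eqI)
    then have "col a \<noteq> col b" using L[OF that(2)] by metis
    moreover have "{a, a', b, b'} \<subseteq> A" using that K(1) LA by auto
    moreover have "col a = col a'" "col b = col b'"
      using K(2)[OF that(1)] L[OF that(2)] by auto
    ultimately show "u a < u b \<longleftrightarrow> u a' < u b'" "u b < u a \<longleftrightarrow> u b' < u a'"
      using col by (metis insert_subset less_asym linorder_neqE_nat)+
  qed
  have KL_band: "v a < v b \<longleftrightarrow> v a' < v b'" "v b < v a \<longleftrightarrow> v b' < v a'" 
    if "(a, a') \<in> K" "(b, b') \<in> L" for a a' b b'
  proof -
    have "{a, a', b, b'} \<subseteq> A" using that K(1) LA by auto
    moreover have "band a < band b" "band a' < band b'"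
      using K(2)[OF that(1)] L[OF that(2)] by auto
    ultimately show "v a < v b \<longleftrightarrow> v a' < v b'" "v b < v a \<longleftrightarrow> v b' < v a'"
      using band by (metis insert_subset less_asym)+
  qed
  have "K \<inter> L = {}"
    using K(2) L by (metis (no_types, lifting) disjoint_iff less_irrefl surj_pair)
  then have card: "card (K \<union> L) = card K + card S"
    using finK cardL by (simp add: card_Un_disjoint)
  \<comment> \<open>The new pairs pay for all of \<open>T'\<close>: each is worth \<open>q\<close>
    triples, by the cube root bound on \<open>S\<close> and the assumption on
    \<open>q\<close>.\<close>
  have "real (card T') \<le> real (card S) * q"
    using S(5) T(1) by (intro q[of _ j]) (auto simp: T'_def intro: card_mono)
  \<comment> \<open>Enlarging the set of used columns can only remove unpaid triples from the
    earlier bands, and the unpaid ones of band \<open>j\<close> lie in \<open>T'\<close>.\<close>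
  moreover have "card {t \<in> T. band (hd t) < Suc j \<and> col (hd t) \<notin> col ` fst ` (K \<union> L)} \<le>
    card ({t \<in> T. band (hd t) < j \<and> col (hd t) \<notin> col ` fst ` K} \<union> T')"
    using T(1) finT' by (intro card_mono) (auto simp: T'_def)
  then have "card {t \<in> T. band (hd t) < Suc j \<and> col (hd t) \<notin> col ` fst ` (K \<union> L)} \<le>
    card {t \<in> T. band (hd t) < j \<and> col (hd t) \<notin> col ` fst ` K} + card T'"
    using card_Un_le le_trans by blast
  ultimately have "real (card {t \<in> T. band (hd t) < Suc j \<and> col (hd t) \<notin> col ` fst ` (K \<union> L)}) \<le>
    real (card (K \<union> L)) * q"
    using K(6) unfolding card by (simp add: distrib_right)
  moreover have "comonotone {u} (K \<union> L)"
    using K(3) by (rule comonotone_Un) (use L_u KL_col in \<open>auto intro: comonotoneI\<close>)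
  moreover have "comonotone {v} (K \<union> L)"
    using K(4) by (rule comonotone_Un) (use L_v KL_band in \<open>auto intro: comonotoneI\<close>)
  moreover have "fst ` (K \<union> L) \<inter> snd ` (K \<union> L) = {}"
  proof -
    have "band x < j" if x: "x \<in> fst ` K \<union> snd ` K" for x
    proof -
      obtain a a' where "(a, a') \<in> K" "x = a \<or> x = a'" using x by auto
      then show ?thesis using K(2)[of a a'] by auto
    qed
    moreover have "band x = j" if x: "x \<in> fst ` L \<union> snd ` L" for x
    proof -
      obtain a a' where "(a, a') \<in> L" "x = a \<or> x = a'" using x by auto
      then show ?thesis using L[of a a'] by auto
    qed
    ultimately have "(fst ` K \<union> snd ` K) \<inter> (fst ` L \<union> snd ` L) = {}"
      by (metis disjoint_iff less_irrefl)
    then have "fst ` K \<inter> snd ` L = {}" "fst ` L \<inter> snd ` K = {}"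
      by auto
    then show ?thesis
      using K(5) \<open>fst ` L \<inter> snd ` L = {}\<close> by (simp add: image_Un Int_Un_distrib Int_Un_distrib2)
  qed
  moreover have "\<forall>(a, a')\<in>K \<union> L. band a < Suc j \<and> col a = col a' \<and> band a = band a'"
    using K(2) L by (auto simp: less_Suc_eq)
  moreover have "K \<union> L \<subseteq> A \<times> A"
    using K(1) LA by simp
  ultimately show ?case
    by (intro exI[of _ "K \<union> L"] conjI) assumption+
qed

section \<open>The grid argument for permutations\<close>

lemma card_div_eq_le:
  assumes "finite A" "inj_on u A" "0 < s"
  shows "card {a \<in> A. u a div s = (c::nat)} \<le> s"
proof -
  have "u ` {a \<in> A. u a div s = c} \<subseteq> {c * s..<c * s + s}"
  proof (rule image_subsetI)
    fix a assume "a \<in> {a \<in> A. u a div s = c}"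
    then have c: "c = u a div s" by simp
    have "u a = u a div s * s + u a mod s" by simp
    moreover have "u a mod s < s" using assms(3) by simp
    ultimately show "u a \<in> {c * s..<c * s + s}" unfolding c atLeastLessThan_iff by linarith
  qed
  then have "card (u ` {a \<in> A. u a div s = c}) \<le> s"
    using card_mono[of "{c * s..<c * s + s}"] by fastforce
  moreover have "inj_on u {a \<in> A. u a div s = c}"
    using assms(2) by (rule inj_on_subset) auto
  ultimately show ?thesis by (simp add: card_image)
qed

text \<open>Columns have width \<open>s\<close> and bands have height \<open>h\<close>. Each of the
  at most \<open>(N/s + 1) * (N/h + 1)\<close> cells leaves at most two points outside its triples.
  Every triple is either paid for by the greedy pairs, at \<open>q\<close> triples per pair, or lies
  in a used column, which holds at most \<open>s/3\<close> triples. Counting three points per triple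
  gives the factor \<open>3 * q + s\<close>.\<close>

lemma twins_from_grid:
  fixes u v :: "'a \<Rightarrow> nat" and q :: real
  assumes A: "finite A" "card A = N" "bij_betw u A {..<N}" "bij_betw v A {..<N}"
    and sh: "0 < s" "0 < h"
    and q: "\<And>l M :: nat. 3 * M \<le> h \<Longrightarrow> M \<le> l ^ 3 \<Longrightarrow> real M \<le> real l * q"
  shows "\<exists>K\<subseteq>A \<times> A. comonotone {u} K \<and> comonotone {v} K \<and> fst ` K \<inter> snd ` K = {} \<and>
    real N - 2 * (real N / real s + 1) * (real N / real h + 1) \<le> real (card K) * (3 * q + real s)"
proof -
  define col where "col a = u a div s" for a
  define band where "band a = v a div h" for a
  \<comment> \<open>The extra one accounts for a last column, or band, that may be
    incomplete.\<close>
  define C where "C = N div s + 1"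
  define B where "B = N div h + 1"
  define cell where "cell = (\<lambda>(c, b). {a \<in> A. col a = c \<and> band a = b})"
  have inj: "inj_on u A" "inj_on v A" and lt: "\<And>a. a \<in> A \<Longrightarrow> u a < N" "\<And>a. a \<in> A \<Longrightarrow> v a < N"
    using A(3,4) by (auto simp: bij_betw_def)
  define good where "good = (\<lambda>Z T. finite T \<and> card Z < 3 * card T + 3 \<and>
    (\<forall>t\<in>T. length t = 3 \<and> distinct t \<and> set t \<subseteq> Z) \<and>
    (\<forall>t\<in>T. \<forall>t'\<in>T. t \<noteq> t' \<longrightarrow> (\<forall>a\<in>set t. \<forall>b\<in>set t'. u a < u b) \<or> (\<forall>a\<in>set t. \<forall>b\<in>set t'. u b < u a)))"
  have "\<exists>T. good (cell p) T" for p
    unfolding good_def cell_def by (rule consecutive_blocks) (use A(1) inj(1) in \<open>auto intro: inj_on_subset split: prod.splits\<close>)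
  then obtain TT where TT: "\<And>p. good (cell p) (TT p)" by metis
  define T where "T = (\<Union>p\<in>{..<C} \<times> {..<B}. TT p)"
  have TT3: "length t = 3" "distinct t" "set t \<subseteq> cell p" "hd t \<in> set t" if "t \<in> TT p" for t p
  proof -
    show t: "length t = 3" "distinct t" "set t \<subseteq> cell p" using that TT[of p] by (auto simp: good_def)
    have "t \<noteq> []" using t(1) by force
    then show "hd t \<in> set t" by simp
  qed
  have TT_cell: "p = (col a, band a)" if "t \<in> TT p" "a \<in> set t" for t p a
    using TT3(3)[OF that(1)] that(2) by (auto simp: cell_def split: prod.splits)
  have TT_T: "t \<in> TT (col (hd t), band (hd t))" if "t \<in> T" for t
    using that TT_cell TT3(4) unfolding T_def by (metis UN_E)
  have T: "finite T" "\<And>t. t \<in> T \<Longrightarrow> length t = 3 \<and> distinct t \<and> set t \<subseteq> A"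
  proof -
    show "finite T" using TT by (auto simp: T_def good_def)
    show "length t = 3 \<and> distinct t \<and> set t \<subseteq> A" if "t \<in> T" for t
      using TT3[OF TT_T[OF that]] by (auto simp: cell_def)
  qed
  have cell: "col a = col b \<and> band a = band b" if "t \<in> T" "a \<in> set t" "b \<in> set t" for t a b
    using TT_cell[OF TT_T[OF that(1)] that(2)] TT_cell[OF TT_T[OF that(1)] that(3)] by simp
  have sep: "(\<forall>a\<in>set t. \<forall>b\<in>set t'. u a < u b) \<or> (\<forall>a\<in>set t. \<forall>b\<in>set t'. u b < u a)"
    if "t \<in> T" "t' \<in> T" "t \<noteq> t'" "col (hd t) = col (hd t')" "band (hd t) = band (hd t')" for t t'
    using TT_T[OF that(1)] TT_T[OF that(2)] that(3-5) TT[of "(col (hd t), band (hd t))"]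
    unfolding good_def by metis
  have hdT: "hd t \<in> set t" if "t \<in> T" for t
    using TT3(4) TT_T[OF that] by blast
  have disj: "set t \<inter> set t' = {}" if "t \<in> T" "t' \<in> T" "t \<noteq> t'" for t t'
  proof (rule ccontr)
    assume "set t \<inter> set t' \<noteq> {}"
    then obtain a where a: "a \<in> set t" "a \<in> set t'" by blast
    then have "col (hd t) = col (hd t') \<and> band (hd t) = band (hd t')"
      using cell[OF that(1) a(1) hdT[OF that(1)]] cell[OF that(2) a(2) hdT[OF that(2)]] by simp
    then show False using sep[OF that] a by (meson less_irrefl)
  qed
  have col_lt: "u a < u b" if "col a < col b" for a b
    using that unfolding col_def by (metis div_le_mono leD leI)
  have band_lt: "v a < v b" if "band a < band b" for a b
    using that unfolding band_def by (metis div_le_mono leD leI)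
  have sub_le: "3 * card {t \<in> T. P (hd t)} \<le> card {a \<in> A. P a}"
    if "\<And>t a. t \<in> T \<Longrightarrow> a \<in> set t \<Longrightarrow> P a = P (hd t)" for P
    by (rule three_card_triples_le) (use A(1) T that disj in auto)
  have col_card: "3 * card {t \<in> T. col (hd t) = c} \<le> s" for c
  proof -
    have "3 * card {t \<in> T. col (hd t) = c} \<le> card {a \<in> A. col a = c}"
      by (rule sub_le) (metis cell hdT)
    also have "\<dots> \<le> s"
      unfolding col_def by (rule card_div_eq_le) (use A inj sh in auto)
    finally show ?thesis .
  qed
  have band_card: "3 * card {t \<in> T. band (hd t) = b} \<le> h" for b
  proof -
    have "3 * card {t \<in> T. band (hd t) = b} \<le> card {a \<in> A. band a = b}"
      by (rule sub_le) (metis cell hdT)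
    also have "\<dots> \<le> h"
      unfolding band_def by (rule card_div_eq_le) (use A inj sh in auto)
    finally show ?thesis .
  qed
  have colC: "col a < C" and bandB: "band a < B" if "a \<in> A" for a
    using lt[OF that] div_le_mono[of "u a" N s] div_le_mono[of "v a" N h]
    by (auto simp: col_def band_def C_def B_def)
  have N_le: "N \<le> 3 * card T + 2 * (C * B)"
  proof -
    have "A = (\<Union>p\<in>{..<C} \<times> {..<B}. cell p)"
      using colC bandB by (auto simp: cell_def)
    then have "N \<le> (\<Sum>p\<in>{..<C} \<times> {..<B}. card (cell p))"
      using A(2) card_UN_le[of "{..<C} \<times> {..<B}" cell] by auto
    also have "\<dots> \<le> (\<Sum>p\<in>{..<C} \<times> {..<B}. 3 * card (TT p) + 2)"
    proof (rule sum_mono)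
      show "card (cell p) \<le> 3 * card (TT p) + 2" for p
        using TT[of p] unfolding good_def by linarith
    qed
    also have "\<dots> = 3 * (\<Sum>p\<in>{..<C} \<times> {..<B}. card (TT p)) + 2 * (C * B)"
      unfolding sum.distrib sum_distrib_left by simp
    also have "(\<Sum>p\<in>{..<C} \<times> {..<B}. card (TT p)) = card T"
      unfolding T_def
    proof (rule card_UN_disjoint[symmetric])
      show "\<forall>p\<in>{..<C} \<times> {..<B}. finite (TT p)" using TT by (auto simp: good_def)
      show "\<forall>p\<in>{..<C} \<times> {..<B}. \<forall>p'\<in>{..<C} \<times> {..<B}. p \<noteq> p' \<longrightarrow> TT p \<inter> TT p' = {}"
        using TT_cell TT3(4) by (metis disjoint_iff)
    qed simp
    finally show ?thesis .
  qed
  have q': "real M \<le> real l * q" if "M \<le> card {t \<in> T. band (hd t) = j}" "M \<le> l ^ 3" for j l M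
    using q[of M l] that band_card[of j] by linarith
  \<comment> \<open>Taking \<open>j = B\<close> in the greedy lemma exhausts all bands.\<close>
  have "\<exists>K\<subseteq>A \<times> A. (\<forall>(a, a')\<in>K. band a < B \<and> col a = col a' \<and> band a = band a') \<and>
    comonotone {u} K \<and> comonotone {v} K \<and> fst ` K \<inter> snd ` K = {} \<and>
    real (card {t \<in> T. band (hd t) < B \<and> col (hd t) \<notin> col ` fst ` K}) \<le> real (card K) * q"
    by (rule greedy_pairs[OF A(1) inj(2) col_lt band_lt T cell sep q'])
  then obtain K where K: "K \<subseteq> A \<times> A" "comonotone {u} K" "comonotone {v} K" "fst ` K \<inter> snd ` K = {}"
    "real (card {t \<in> T. band (hd t) < B \<and> col (hd t) \<notin> col ` fst ` K}) \<le> real (card K) * q"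
    by (elim exE conjE)
  define U where "U = col ` fst ` K"
  have finK: "finite K" using K(1) A(1) by (auto intro: finite_subset)
  then have U: "finite U" "card U \<le> card K"
    unfolding U_def by (auto intro: card_image_le order_trans)
  \<comment> \<open>There are at most as many used columns as pairs, and each holds at most
    \<open>s/3\<close> triples.\<close>
  have "3 * card {t \<in> T. col (hd t) \<in> U} \<le> card K * s"
  proof -
    have "{t \<in> T. col (hd t) \<in> U} = (\<Union>c\<in>U. {t \<in> T. col (hd t) = c})" by auto
    then have "card {t \<in> T. col (hd t) \<in> U} \<le> (\<Sum>c\<in>U. card {t \<in> T. col (hd t) = c})"
      using card_UN_le[OF U(1)] by simp
    then have "3 * card {t \<in> T. col (hd t) \<in> U} \<le> (\<Sum>c\<in>U. 3 * card {t \<in> T. col (hd t) = c})"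
      by (simp add: sum_distrib_left[symmetric])
    also have "\<dots> \<le> (\<Sum>c\<in>U. s)" by (intro sum_mono col_card)
    also have "\<dots> \<le> card K * s" using U(2) by simp
    finally show ?thesis .
  qed
  moreover have "card T \<le> card {t \<in> T. band (hd t) < B \<and> col (hd t) \<notin> U} + card {t \<in> T. col (hd t) \<in> U}"
  proof -
    have "T \<subseteq> {t \<in> T. band (hd t) < B \<and> col (hd t) \<notin> U} \<union> {t \<in> T. col (hd t) \<in> U}"
      using bandB hdT T(2) by blast
    then have "card T \<le> card ({t \<in> T. band (hd t) < B \<and> col (hd t) \<notin> U} \<union> {t \<in> T. col (hd t) \<in> U})"
      using T(1) by (intro card_mono) auto
    then show ?thesis using card_Un_le le_trans by blast
  qed
  ultimately have "N \<le> 3 * card {t \<in> T. band (hd t) < B \<and> col (hd t) \<notin> U} + card K * s + 2 * (C * B)"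
    using N_le by linarith
  then have "real N \<le> 3 * real (card {t \<in> T. band (hd t) < B \<and> col (hd t) \<notin> U}) + real (card K) * real s + 2 * (real C * real B)"
    by (drule_tac of_nat_mono[where 'a = real]) (simp only: of_nat_add of_nat_mult of_nat_numeral)
  also have "\<dots> \<le> 3 * (real (card K) * q) + real (card K) * real s + 2 * (real C * real B)"
    using K(5) unfolding U_def by simp
  finally have "real N - 2 * (real C * real B) \<le> real (card K) * (3 * q + real s)"
    by (simp add: algebra_simps)
  moreover have "real C * real B \<le> (real N / real s + 1) * (real N / real h + 1)"
    unfolding C_def B_def using of_nat_div_le_of_nat[of N s, where 'a = real] of_nat_div_le_of_nat[of N h, where 'a = real]
    by (intro mult_mono) auto
  ultimately have "real N - 2 * (real N / real s + 1) * (real N / real h + 1) \<le> real (card K) * (3 * q + real s)"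
    unfolding mult.assoc by linarith
  then show ?thesis
    using K(1-4) by blast
qed

lemma twins_large:
  fixes u v :: "'a \<Rightarrow> nat" and y :: real
  assumes A: "finite A" "card A = N" "bij_betw u A {..<N}" "bij_betw v A {..<N}"
    and y: "y \<ge> 10" "real N = y ^ 5"
  shows "\<exists>K\<subseteq>A \<times> A. comonotone {u} K \<and> comonotone {v} K \<and> fst ` K \<inter> snd ` K = {} \<and> y ^ 3 / 8 \<le> card K"
proof -
  txt \<open>With N = y^5 this is a grid of about y^3 / 2 columns and y^2 / 3 bands, so at most y^3 triples
    lie in one band and the greedy step applies with q = y^2.\<close>
  define s where "s = nat \<lfloor>2 * y ^ 2\<rfloor>"
  define h where "h = nat \<lfloor>3 * y ^ 3\<rfloor>"
  have y2: "y ^ 2 \<ge> 100" using power_mono[of 10 y 2] y by simp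
  have y3: "y ^ 3 \<ge> 1000" using power_mono[of 10 y 3] y by simp
  \<comment> \<open>Rounding down loses at most 1, which is at most \<open>y^2 / 100\<close> and at
    most \<open>y^3 / 100\<close>.\<close>
  have s: "real s \<le> 2 * y ^ 2" "real s \<ge> 199/100 * y ^ 2"
    unfolding s_def using y2 by linarith+
  have h: "real h \<le> 3 * y ^ 3" "real h \<ge> 299/100 * y ^ 3"
    unfolding h_def using y3 by linarith+
  have "0 < s" "0 < h" using s h y2 y3 by (auto intro!: Nat.gr0I)
  \<comment> \<open>The bounds \<open>M \<le> y^3\<close> and \<open>M \<le> l^3\<close> are
    combined by splitting \<open>M^3\<close> as \<open>M * M^2\<close>, which yields
    \<open>M^3 \<le> (l * y^2)^3\<close>.\<close>
  have q: "real M \<le> real l * y ^ 2" if "3 * M \<le> h" "M \<le> l ^ 3" for l M :: nat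
  proof -
    have M: "real M \<le> y ^ 3" using that(1) h(1) by linarith
    have "real M ^ 3 = real M * (real M) ^ 2" by (simp add: power3_eq_cube power2_eq_square)
    also have "\<dots> \<le> real l ^ 3 * (y ^ 3) ^ 2"
      using that(2) M by (intro mult_mono power_mono) (auto simp flip: of_nat_power)
    also have "\<dots> = (real l * y ^ 2) ^ 3"
      by (simp add: power_mult_distrib flip: power_mult)
    finally show ?thesis
      by (rule power_le_imp_le_base[of _ 2, unfolded Suc_numeral, simplified]) (use y in simp)
  qed
  obtain K where K: "K \<subseteq> A \<times> A" "comonotone {u} K" "comonotone {v} K" "fst ` K \<inter> snd ` K = {}"
    "real N - 2 * (real N / real s + 1) * (real N / real h + 1) \<le> real (card K) * (3 * y ^ 2 + real s)"
    using twins_from_grid[OF A \<open>0 < s\<close> \<open>0 < h\<close> q] by blast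
  have "real N / real s \<le> y ^ 5 / (199/100 * y ^ 2)"
    unfolding y(2) using s y2 y by (intro divide_left_mono) auto
  also have "\<dots> = 100/199 * y ^ 3" using y by (simp add: field_simps eval_nat_numeral)
  finally have 1: "real N / real s + 1 \<le> 51/100 * y ^ 3" using y3 by simp
  have "real N / real h \<le> y ^ 5 / (299/100 * y ^ 3)"
    unfolding y(2) using h y3 y by (intro divide_left_mono) auto
  also have "\<dots> = 100/299 * y ^ 2" using y by (simp add: field_simps eval_nat_numeral)
  finally have 2: "real N / real h + 1 \<le> 35/100 * y ^ 2" using y2 by simp
  have "(real N / real s + 1) * (real N / real h + 1) \<le> (51/100 * y ^ 3) * (35/100 * y ^ 2)"
    using 1 2 y by (intro mult_mono) auto
  also have "\<dots> = 51/100 * (35/100) * y ^ 5" by (simp add: eval_nat_numeral)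
  \<comment> \<open>The wasted points number at most \<open>2 * 0.51 * 0.35 = 0.357\<close> times
    \<open>y^5\<close>, less than \<open>3/8\<close> of all points. The remaining
    \<open>5/8\<close>, divided by \<open>5 * y^2\<close> below, gives
    \<open>y^3 / 8\<close>.\<close>
  finally have "real N - 2 * (real N / real s + 1) * (real N / real h + 1) \<ge> 5/8 * y ^ 5"
    using y(2) unfolding mult.assoc by linarith
  moreover have "real (card K) * (3 * y ^ 2 + real s) \<le> real (card K) * (5 * y ^ 2)"
    using s by (intro mult_left_mono) auto
  ultimately have "5/8 * y ^ 5 \<le> real (card K) * (5 * y ^ 2)"
    using K(5) by linarith
  then have "(y ^ 3 / 8) * (5 * y ^ 2) \<le> real (card K) * (5 * y ^ 2)"
    by (simp add: eval_nat_numeral)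
  then have "y ^ 3 / 8 \<le> card K"
    by (rule mult_right_le_imp_le) (use y in simp)
  then show ?thesis using K by blast
qed

section \<open>Short permutations and the bound for all lengths\<close>

text \<open>A monotone subsequence \<open>C\<close> has at least the square root of
  \<open>card A\<close> elements. Cutting it into consecutive pairs and separating the two members
  of each pair gives twins, with at most one element of \<open>C\<close> left over.\<close>

lemma twins_erdos_szekeres:
  fixes u v :: "'a \<Rightarrow> nat"
  assumes A: "finite A" "inj_on u A" "inj_on v A"
  shows "\<exists>K\<subseteq>A \<times> A. comonotone {u} K \<and> comonotone {v} K \<and> fst ` K \<inter> snd ` K = {} \<and>
    card A \<le> (2 * card K + 1) ^ 2"
proof -
  \<comment> \<open>Index 0 stands for increasing, the other index for decreasing
    subsequences.\<close>
  define R where "R i = {(a, b). u a < u b \<and> (if i = 0 then v a < v b else v b < v a)}" for i :: nat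
  have "\<exists>i\<in>{0, 1}. \<exists>C\<subseteq>A. total_on C (R i) \<and> card A \<le> card C ^ card {0, 1::nat}"
  proof (rule exists_large_chain)
    show "trans (R i)" "irrefl (R i)" for i
      by (auto simp: R_def trans_def irrefl_def split: if_splits)
    show "\<exists>i\<in>{0, 1}. (x, y) \<in> R i \<or> (y, x) \<in> R i" if "x \<in> A" "y \<in> A" "x \<noteq> y" for x y
    proof -
      have "u x \<noteq> u y" "v x \<noteq> v y" using that A(2,3) by (auto simp: inj_on_def)
      then show ?thesis by (auto simp: R_def)
    qed
  qed (use A(1) in auto)
  then obtain i C where C: "C \<subseteq> A" "total_on C (R i)" "card A \<le> card C ^ 2"
    by (auto simp: numeral_2_eq_2)
  have finC: "finite C" using C(1) A(1) finite_subset by blast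
  have dir: "u a < u b \<longleftrightarrow> (if i = 0 then v a < v b else v b < v a)" if "a \<in> C" "b \<in> C" for a b
  proof (cases "a = b")
    case False
    then have "(a, b) \<in> R i \<or> (b, a) \<in> R i" using C(2) that by (auto simp: total_on_def)
    then show ?thesis by (auto simp: R_def split: if_splits)
  qed auto
  obtain T where T: "finite T" "card C < 2 * card T + 2"
    "\<forall>t\<in>T. length t = 2 \<and> distinct t \<and> set t \<subseteq> C"
    "\<forall>t\<in>T. \<forall>t'\<in>T. t \<noteq> t' \<longrightarrow> (\<forall>a\<in>set t. \<forall>b\<in>set t'. u a < u b) \<or> (\<forall>a\<in>set t. \<forall>b\<in>set t'. u b < u a)"
    using consecutive_blocks[OF finC inj_on_subset[OF A(2) C(1)], of 2] by auto
  define K where "K = {(a, b). [a, b] \<in> T}"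
  have T2: "a \<in> C" "b \<in> C" "a \<noteq> b" if "[a, b] \<in> T" for a b
    using T(3) that by fastforce+
  have sep: "[a, b] = [a', b'] \<or> (u a < u a' \<and> u a < u b' \<and> u b < u a' \<and> u b < u b') \<or>
      (u a' < u a \<and> u b' < u a \<and> u a' < u b \<and> u b' < u b)" if "[a, b] \<in> T" "[a', b'] \<in> T" for a b a' b'
    using bspec[OF bspec[OF T(4) that(1)] that(2)] by (cases "[a, b] = [a', b']") auto
  have cu: "comonotone {u} K"
  proof (rule comonotoneI)
    fix a a' b b' f g
    assume "(a, a') \<in> K" "(b, b') \<in> K" "f \<in> {u}" "g \<in> {u}"
    then show "f a < g b \<longleftrightarrow> f a' < g b'"
      using sep[of a a' b b'] by (auto simp: K_def)
  qed
  have "comonotone {v} K"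
  proof (rule comonotoneI)
    fix a a' b b' f g
    assume "(a, a') \<in> K" "(b, b') \<in> K" "f \<in> {v}" "g \<in> {v}"
    then show "f a < g b \<longleftrightarrow> f a' < g b'"
      using comonotoneD[OF cu, of a a' b b'] comonotoneD[OF cu, of b b' a a']
        dir[of a b] dir[of a' b'] dir[of b a] dir[of b' a'] T2[of a a'] T2[of b b']
      by (simp add: K_def split: if_splits)
  qed
  moreover have "fst ` K \<inter> snd ` K = {}"
  proof (rule equals0I)
    fix x assume "x \<in> fst ` K \<inter> snd ` K"
    then obtain a b where "[x, a] \<in> T" "[b, x] \<in> T" by (auto simp: K_def)
    then show False using sep[of x a b x] T2(3)[of x a] by auto
  qed
  moreover have "K \<subseteq> A \<times> A" using T2 C(1) by (auto simp: K_def)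
  \<comment> \<open>Blocks of length two are lists, so they are first identified with the pairs in
    \<open>K\<close>.\<close>
  moreover have "card T = card K"
  proof (rule bij_betw_same_card)
    show "bij_betw (\<lambda>t. (t ! 0, t ! 1)) T K"
    proof (rule bij_betw_imageI)
      have pair: "t = [t ! 0, t ! 1]" if "t \<in> T" for t
        using T(3) that by (auto simp: numeral_2_eq_2 length_Suc_conv)
      show "inj_on (\<lambda>t. (t ! 0, t ! 1)) T"
      proof (rule inj_onI)
        fix t t' assume "t \<in> T" "t' \<in> T" "(t ! 0, t ! 1) = (t' ! 0, t' ! 1)"
        then show "t = t'" using pair[of t] pair[of t'] by simp
      qed
      show "(\<lambda>t. (t ! 0, t ! 1)) ` T = K"
      proof
        show "(\<lambda>t. (t ! 0, t ! 1)) ` T \<subseteq> K"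
        proof (rule image_subsetI)
          show "(t ! 0, t ! 1) \<in> K" if "t \<in> T" for t
            using that pair[OF that] by (simp add: K_def)
        qed
        show "K \<subseteq> (\<lambda>t. (t ! 0, t ! 1)) ` T"
        proof (rule subsetI)
          fix p assume "p \<in> K"
          then obtain a b where "p = (a, b)" "[a, b] \<in> T" by (auto simp: K_def)
          then show "p \<in> (\<lambda>t. (t ! 0, t ! 1)) ` T" by (intro image_eqI[of _ _ "[a, b]"]) auto
        qed
      qed
    qed
  qed
  then have "card C \<le> 2 * card K + 1" using T(2) by simp
  then have "card A \<le> (2 * card K + 1) ^ 2"
    using C(3) by (meson order_trans power_mono zero_le)
  ultimately show ?thesis using cu by blast
qed

theorem twins_in_permutation:
  fixes u :: "'a \<Rightarrow> 'b::linorder" and v :: "'a \<Rightarrow> 'c::linorder"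
  assumes A: "finite A" "inj_on u A" "inj_on v A" and N: "25 \<le> card A"
  shows "\<exists>K\<subseteq>A \<times> A. comonotone {u} K \<and> comonotone {v} K \<and> fst ` K \<inter> snd ` K = {} \<and>
    real (card A) powr (3 / 5) / 8 \<le> card K"
proof -
  let ?u = "rank A u" and ?v = "rank A v"
  \<comment> \<open>With the tenth root all exponents become integers: \<open>w^2\<close>,
    \<open>w^5\<close> and \<open>w^6\<close> are the fifth root, the square root and the target
    power \<open>3/5\<close> of the number of points.\<close>
  define w where "w = real (card A) powr (1 / 10)"
  have w: "w > 0" using N by (simp add: w_def)
  have pow: "w ^ k = real (card A) powr (k / 10)" for k
    using N by (simp add: w_def powr_powr flip: powr_realpow)
  have w10: "w ^ 10 = real (card A)" using N by (simp add: pow)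
  have w6: "w ^ 6 = real (card A) powr (3 / 5)" by (simp add: pow)
  have bij: "bij_betw ?u A {..<card A}" "bij_betw ?v A {..<card A}"
    using A by (auto intro: bij_betw_rank)
  have "\<exists>K\<subseteq>A \<times> A. comonotone {?u} K \<and> comonotone {?v} K \<and> fst ` K \<inter> snd ` K = {} \<and> w ^ 6 / 8 \<le> card K"
  txt \<open>The rounding losses of the grid argument are affordable only for at least 10^5 points; below that
    the Erdos-Szekeres bound of about half the square root is larger.\<close>
  proof (cases "10 \<le> w ^ 2")
    case True
    have "(w ^ 2) ^ 3 = w ^ 6" "(w ^ 2) ^ 5 = w ^ 10" by (simp_all flip: power_mult)
    then show ?thesis using twins_large[OF A(1) refl bij True] w10 by simp
  next
    case False
    obtain K where K: "K \<subseteq> A \<times> A" "comonotone {?u} K" "comonotone {?v} K" "fst ` K \<inter> snd ` K = {}"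
      "card A \<le> (2 * card K + 1) ^ 2"
      using twins_erdos_szekeres[OF A(1)] bij unfolding bij_betw_def by metis
    have "(w ^ 5) ^ 2 = w ^ 10" by (simp flip: power_mult)
    also have "\<dots> \<le> (2 * real (card K) + 1) ^ 2"
      unfolding w10 using of_nat_mono[OF K(5), where 'a = real]
      by (simp only: of_nat_power of_nat_add of_nat_mult of_nat_numeral of_nat_1)
    finally have le: "w ^ 5 \<le> 2 * real (card K) + 1"
      by (rule power2_le_imp_le) simp
    have "w \<le> 16 / 5"
    proof (rule power2_le_imp_le)
      show "w\<^sup>2 \<le> (16 / 5)\<^sup>2" using False by (simp add: power2_eq_square)
    qed simp
    \<comment> \<open>Here the bound of 25 points enters: \<open>w^5 \<ge> 5\<close> and
      \<open>4 - w \<ge> 4/5\<close> give \<open>w^6 \<le> 4 * w^5 - 4\<close>, and this is at most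
      \<open>8 * card K\<close> by \<open>le\<close>.\<close>
    have "(w ^ 5) ^ 2 \<ge> 5 ^ 2" using N w10 by (simp flip: power_mult)
    then have "w ^ 5 \<ge> 5" by (rule power2_le_imp_le) (use w in simp)
    then have "w ^ 5 * (4 - w) \<ge> 5 * (4 / 5)"
      using \<open>w \<le> 16 / 5\<close> w by (intro mult_mono) auto
    then have "w ^ 6 \<le> 4 * w ^ 5 - 4" by (simp add: eval_nat_numeral algebra_simps)
    then show ?thesis using K(1-4) le by (intro exI[of _ K]) simp
  qed
  then obtain K where K: "K \<subseteq> A \<times> A" "comonotone {?u} K" "comonotone {?v} K" "fst ` K \<inter> snd ` K = {}" "w ^ 6 / 8 \<le> card K"
    by blast
  \<comment> \<open>Ranks compare exactly as the original values do, so the result transfers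
    back.\<close>
  have "comonotone {f} K" if "comonotone {rank A f} K" for f :: "'a \<Rightarrow> 'd::linorder"
  proof (rule comonotoneI)
    fix a a' b b' g h
    assume "(a, a') \<in> K" "(b, b') \<in> K" "g \<in> {f}" "h \<in> {f}"
    then show "g a < h b \<longleftrightarrow> g a' < h b'"
      using comonotoneD[OF that, of a a' b b' "rank A f" "rank A f"] K(1)
        rank_less_iff[OF A(1), of a b f] rank_less_iff[OF A(1), of a' b' f] by auto
  qed
  from this[OF K(2)] this[OF K(3)] show ?thesis
    using K(1,4,5) unfolding w6 by (intro exI[of _ K] conjI)
qed

section \<open>From permutations to matchings\<close>

text \<open>The two sides are the fifth roots of \<open>1/32\<close> and
  \<open>1/27\<close>.\<close>

lemma third_powr_ge_half: "1 / 2 \<le> (1 / 3 :: real) powr (3 / 5)"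
proof -
  have "1 / 2 = ((1 / 2 :: real) powr 5) powr (1 / 5)" unfolding powr_powr by simp
  also have "(1 / 2 :: real) powr 5 = 1 / 32" by (simp add: power_divide)
  also have "(1 / 32 :: real) powr (1 / 5) \<le> (1 / 27) powr (1 / 5)" by (intro powr_mono2) auto
  also have "(1 / 27 :: real) = (1 / 3) powr 3" by (simp add: power_divide)
  also have "((1 / 3 :: real) powr 3) powr (1 / 5) = (1 / 3) powr (3 / 5)" unfolding powr_powr by simp
  finally show ?thesis .
qed

lemma powr_32: "(32 :: real) powr (3 / 5) = 8"
proof -
  have "(32 :: real) = 2 powr 5" by simp
  then have "(32 :: real) powr (3 / 5) = 2 powr (5 * (3 / 5))" by (simp only: powr_powr)
  then show ?thesis by simp
qed

lemma twins_in_matching: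
  fixes l r :: "'a \<Rightarrow> 'b::linorder"
  assumes "finite M" "inj_on l M" "inj_on r M" "\<And>e. e \<in> M \<Longrightarrow> l e < r e" "2 \<le> card M"
  shows "\<exists>K\<subseteq>M \<times> M. comonotone {l, r} K \<and> fst ` K \<inter> snd ` K = {} \<and>
    1 / 8 * (real (card M) / 4) powr (3 / 5) \<le> card K"
  using assms
proof (induction "card M" arbitrary: M rule: less_induct)
  case less
  note M = less.prems
  define n where "n = card M"
  show ?case
  proof (cases "n \<le> 128")
    case True
    obtain e d where ed: "e \<in> M" "d \<in> M" "e \<noteq> d"
      using M(1,5) by (metis One_nat_def Suc_1 card_le_Suc0_iff_eq not_less_eq_eq)
    have "(real n / 4) powr (3 / 5) \<le> 32 powr (3 / 5)"
      using True by (intro powr_mono2) auto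
    then have "1 / 8 * (real n / 4) powr (3 / 5) \<le> card {(e, d)}"
      unfolding powr_32 by simp
    moreover have "comonotone {l, r} {(e, d)}"
      using M(4)[OF ed(1)] M(4)[OF ed(2)] by (auto simp: comonotone_def)
    ultimately show ?thesis
      using ed unfolding n_def by (intro exI[of _ "{(e, d)}"] conjI) auto
  next
    case False
    \<comment> \<open>\<open>k\<close> is \<open>n/3\<close> rounded up. \<open>L\<close> takes the
      \<open>k\<close> edges with the smallest right endpoints and \<open>m\<close> is the last of
      these endpoints, so every other edge either crosses \<open>m\<close> (the set
      \<open>X\<close>) or lies to its right (the set \<open>R\<close>).\<close>
    define k where "k = (n + 2) div 3"
    have k: "n \<le> 3 * k" "3 * k \<le> n + 2" unfolding k_def by linarith+
    then have "k \<le> card M" using False by (simp add: n_def)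
    then obtain L where L: "L \<subseteq> M" "card L = k" "\<And>b a. b \<in> L \<Longrightarrow> a \<in> M - L \<Longrightarrow> r b < r a"
      using initial_segment[OF M(1,3)] by metis
    have finL: "finite L" using L(1) M(1) finite_subset by blast
    have "L \<noteq> {}" using L(2) k False by auto
    define m where "m = Max (r ` L)"
    have "m \<in> r ` L" unfolding m_def using finL \<open>L \<noteq> {}\<close> by simp
    have rL: "r e \<le> m" if "e \<in> L" for e
      unfolding m_def using finL that by simp
    have rM: "m < r e" if "e \<in> M - L" for e
      using \<open>m \<in> r ` L\<close> L(3) that by blast
    define X where "X = {e \<in> M. l e \<le> m \<and> m < r e}"
    define R where "R = {e \<in> M. m < l e}"
    have XM: "X \<subseteq> M" and RM: "R \<subseteq> M" by (auto simp: X_def R_def)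
    have fin: "finite X" "finite R" using M(1) XM RM finite_subset by blast+
    have "M \<subseteq> L \<union> (X \<union> R)" using rM by (auto simp: X_def R_def not_le)
    then have "card M \<le> card (L \<union> (X \<union> R))" using finL fin by (intro card_mono) auto
    also have "\<dots> \<le> card L + (card X + card R)" by (meson card_Un_le order_trans add_left_mono)
    finally have n_le: "n \<le> k + card X + card R" using L(2) by (simp add: n_def)
    show ?thesis
    proof (cases "n \<le> 4 * card X")
      case True
      \<comment> \<open>More than 128 edges, a quarter of them crossing \<open>m\<close>, exceed the
        threshold for permutations.\<close>
      have "25 \<le> card X" using True False by linarith
      then obtain K where K: "K \<subseteq> X \<times> X" "comonotone {l} K" "comonotone {r} K" "fst ` K \<inter> snd ` K = {}"
        "real (card X) powr (3 / 5) / 8 \<le> card K"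
        using twins_in_permutation[OF fin(1) inj_on_subset[OF M(2) XM] inj_on_subset[OF M(3) XM]] by blast
      \<comment> \<open>All left endpoints in \<open>X\<close> precede all right endpoints, so mixed
        comparisons agree automatically and the others come from the two coordinates of the
        permutation.\<close>
      have "comonotone {l, r} K"
      proof (rule comonotoneI)
        fix a a' b b' f g
        assume ab: "(a, a') \<in> K" "(b, b') \<in> K" and fg: "f \<in> {l, r}" "g \<in> {l, r}"
        have "{a, a', b, b'} \<subseteq> X" using ab K(1) by auto
        then have "l x < r y" if "x \<in> {a, a', b, b'}" "y \<in> {a, a', b, b'}" for x y
          using that unfolding X_def by (blast intro: le_less_trans)
        then show "f a < g b \<longleftrightarrow> f a' < g b'"
          using fg comonotoneD[OF K(2) ab, of l l] comonotoneD[OF K(3) ab, of r r]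
          by (metis insertCI insertE less_asym singletonD)
      qed
      moreover have "(real n / 4) powr (3 / 5) \<le> real (card X) powr (3 / 5)"
        using True by (intro powr_mono2) auto
      then have "1 / 8 * (real n / 4) powr (3 / 5) \<le> card K" using K(5) by simp
      ultimately show ?thesis
        using K(1,4) XM unfolding n_def by blast
    next
      case X: False
      \<comment> \<open>What remains for \<open>R\<close> exceeds
        \<open>n - (n + 2)/3 - n/4\<close>, which is at least \<open>n/3\<close> for
        \<open>n\<close> this large.\<close>
      have R: "n \<le> 3 * card R" using n_le X k(2) False by linarith
      have "L \<inter> R = {}"
      proof (rule equals0I)
        fix e assume "e \<in> L \<inter> R"
        then show False using rL[of e] M(4)[of e] RM by (auto simp: R_def)
      qed
      then have LR: "card L + card R \<le> card M"
        using card_mono[OF M(1), of "L \<union> R"] L(1) RM finL fin by (simp add: card_Un_disjoint)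
      txt \<open>Each side keeps at least a third of the edges, which suffices because 2 * (1/3)^(3/5) \<ge> 1.\<close>
      have IH: "\<exists>K\<subseteq>S \<times> S. comonotone {l, r} K \<and> fst ` K \<inter> snd ` K = {} \<and>
          1 / 16 * (real n / 4) powr (3 / 5) \<le> card K"
        if S: "S \<subseteq> M" "card S < card M" "n \<le> 3 * card S" for S
      proof -
        have "2 \<le> card S" using S(3) False by linarith
        moreover have "finite S" using S(1) M(1) finite_subset by blast
        ultimately obtain K where K: "K \<subseteq> S \<times> S" "comonotone {l, r} K" "fst ` K \<inter> snd ` K = {}"
          "1 / 8 * (real (card S) / 4) powr (3 / 5) \<le> card K"
          using less.hyps[OF S(2) _ inj_on_subset[OF M(2) S(1)] inj_on_subset[OF M(3) S(1)]] M(4) S(1) by blast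
        have "1 / 2 * (real n / 4) powr (3 / 5) \<le> (1 / 3) powr (3 / 5) * (real n / 4) powr (3 / 5)"
          by (intro mult_right_mono third_powr_ge_half) simp
        also have "\<dots> = (1 / 3 * (real n / 4)) powr (3 / 5)" by (rule powr_mult[symmetric])
        also have "\<dots> \<le> (real (card S) / 4) powr (3 / 5)" using S(3) by (intro powr_mono2) auto
        finally show ?thesis using K by (intro exI[of _ K]) simp
      qed
      have "card L < card M" "card R < card M" using LR L(2) k R False by linarith+
      then obtain K1 K2 where K1: "K1 \<subseteq> L \<times> L" "comonotone {l, r} K1" "fst ` K1 \<inter> snd ` K1 = {}"
          "1 / 16 * (real n / 4) powr (3 / 5) \<le> card K1"
        and K2: "K2 \<subseteq> R \<times> R" "comonotone {l, r} K2" "fst ` K2 \<inter> snd ` K2 = {}"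
          "1 / 16 * (real n / 4) powr (3 / 5) \<le> card K2"
        using IH[OF L(1)] IH[OF RM] L(2) k(1) R by metis
      \<comment> \<open>The point \<open>m\<close> separates \<open>L\<close> from \<open>R\<close>,
        so the twins found on the two sides can be concatenated.\<close>
      have lt: "f a < g b" if "a \<in> L" "b \<in> R" "f \<in> {l, r}" "g \<in> {l, r}" for a b f g
      proof -
        have "f a \<le> m" using that(1,3) rL[of a] M(4)[of a] L(1) by auto
        also have "m < g b" using that(2,4) M(4)[of b] by (auto simp: R_def)
        finally show ?thesis .
      qed
      have "comonotone {l, r} (K1 \<union> K2)"
      proof (rule comonotone_Un[OF K1(2) K2(2)])
        fix a a' b b' f g
        assume *: "(a, a') \<in> K1" "(b, b') \<in> K2" "f \<in> {l, r}" "g \<in> {l, r}"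
        have "a \<in> L" "a' \<in> L" "b \<in> R" "b' \<in> R" using * K1(1) K2(1) by auto
        then have "f a < g b" "f a' < g b'" using lt *(3,4) by blast+
        then show "f a < g b \<longleftrightarrow> f a' < g b'" "g b < f a \<longleftrightarrow> g b' < f a'" by auto
      qed
      moreover have "fst ` (K1 \<union> K2) \<inter> snd ` (K1 \<union> K2) = {}"
      proof -
        have "fst ` K1 \<subseteq> L" "snd ` K1 \<subseteq> L" "fst ` K2 \<subseteq> R" "snd ` K2 \<subseteq> R" using K1(1) K2(1) by auto
        then have "fst ` K1 \<inter> snd ` K2 \<subseteq> L \<inter> R" "fst ` K2 \<inter> snd ` K1 \<subseteq> L \<inter> R" by auto
        then show ?thesis
          using K1(3) K2(3) \<open>L \<inter> R = {}\<close> by (simp add: image_Un Int_Un_distrib Int_Un_distrib2)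
      qed
      moreover have "card (K1 \<union> K2) = card K1 + card K2"
      proof (rule card_Un_disjoint)
        show "finite K1" "finite K2"
          using K1(1) K2(1) finL fin by (auto intro: finite_subset)
        show "K1 \<inter> K2 = {}" using K1(1) K2(1) \<open>L \<inter> R = {}\<close> by blast
      qed
      then have "1 / 8 * (real n / 4) powr (3 / 5) \<le> card (K1 \<union> K2)"
        using K1(4) K2(4) by simp
      moreover have "K1 \<union> K2 \<subseteq> M \<times> M" using K1(1) K2(1) L(1) RM by blast
      ultimately show ?thesis unfolding n_def by blast
    qed
  qed
qed

section \<open>From comonotone pairs to twins\<close>

text \<open>A strictly increasing map sends the sorted list of \<open>V\<close> to the sorted list
  of its image, so the index-based definition can be checked on points \<open>x < y\<close>.\<close>

lemma order_isomorphic_strict_mono: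
  assumes V: "finite V" and mono: "\<And>x y. x \<in> V \<Longrightarrow> y \<in> V \<Longrightarrow> x < y \<Longrightarrow> \<phi> x < \<phi> y"
    and edges: "\<And>x y. x \<in> V \<Longrightarrow> y \<in> V \<Longrightarrow> x < y \<Longrightarrow> {x, y} \<in> E \<longleftrightarrow> {\<phi> x, \<phi> y} \<in> F"
  shows "order_isomorphic V E (\<phi> ` V) F"
proof -
  have "inj_on \<phi> V"
    using mono by (intro linorder_inj_onI') (auto simp: less_imp_neq)
  then have card: "card (\<phi> ` V) = card V" by (rule card_image)
  let ?xs = "sorted_list_of_set V"
  have xs: "sorted_wrt (<) ?xs" "set ?xs = V" "length ?xs = card V"
    using V by auto
  have "sorted_wrt (<) (map \<phi> ?xs)"
    unfolding sorted_wrt_map using xs(1) by (rule sorted_wrt_mono_rel[rotated]) (use mono xs(2) in blast)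
  then have map: "sorted_list_of_set (\<phi> ` V) = map \<phi> ?xs"
    using V xs(2) by (intro strict_sorted_equal) auto
  have "{?xs ! i, ?xs ! j} \<in> E \<longleftrightarrow> {map \<phi> ?xs ! i, map \<phi> ?xs ! j} \<in> F" if "i < j" "j < card V" for i j
  proof -
    have ij: "i < length ?xs" "j < length ?xs" using that xs(3) by simp_all
    have "?xs ! i < ?xs ! j" using sorted_wrt_nth_less[OF xs(1)] that ij by blast
    moreover have "?xs ! i \<in> V" "?xs ! j \<in> V" using nth_mem[OF ij(1)] nth_mem[OF ij(2)] xs(2) by auto
    ultimately show ?thesis using edges ij by simp
  qed
  then show ?thesis
    unfolding order_isomorphic_def map using V card by simp
qed

lemma card_2_Min_Max:
  fixes e :: "'a::linorder set"
  assumes "card e = 2"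
  shows "e = {Min e, Max e}" "Min e < Max e"
proof -
  obtain x y where e: "e = {x, y}" "x \<noteq> y" using assms by (auto simp: card_2_iff)
  show "Min e < Max e" "e = {Min e, Max e}"
    using e by (auto simp: min_def max_def)
qed

text \<open>Sending the lower and upper end of each edge to those of its partner is an increasing
  bijection of the vertex sets, and it carries edges to edges.\<close>

lemma twins_of_comonotone:
  fixes M :: "'a::linorder set set"
  assumes M: "finite M" "\<And>e. e \<in> M \<Longrightarrow> card e = 2" "pairwise disjnt M"
    and K: "K \<subseteq> M \<times> M" "comonotone {Min, Max} K" "fst ` K \<inter> snd ` K = {}"
  shows "twins M (fst ` K) (snd ` K) \<and> card (fst ` K) = card K"
proof -
  have ends: "e = {Min e, Max e}" "Min e < Max e" if "e \<in> M" for e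
    using card_2_Min_Max[OF M(2)[OF that]] by blast+
  have disj: "e = d" if "e \<in> M" "d \<in> M" "x \<in> e" "x \<in> d" for e d x
    using M(3) that by (auto simp: pairwise_def disjnt_def)
  have KM: "e \<in> M" "e' \<in> M" if "(e, e') \<in> K" for e e'
    using that K(1) by auto
  \<comment> \<open>The vertex map starts as a relation; comonotonicity makes it order preserving,
    and by trichotomy it is then single-valued and injective.\<close>
  define Rel where "Rel = {(f e, f e') | f e e'. f \<in> {Min, Max} \<and> (e, e') \<in> K}"
  have Rel_less: "x < y \<longleftrightarrow> x' < y'" if xy: "(x, x') \<in> Rel" "(y, y') \<in> Rel" for x x' y y'
  proof -
    obtain f e e' g d d' where "f \<in> {Min, Max}" "(e, e') \<in> K" "x = f e" "x' = f e'"
      "g \<in> {Min, Max}" "(d, d') \<in> K" "y = g d" "y' = g d'"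
      using xy unfolding Rel_def by blast
    then show ?thesis using comonotoneD[OF K(2)] by blast
  qed
  have Rel_eq: "x = y \<longleftrightarrow> x' = y'" if "(x, x') \<in> Rel" "(y, y') \<in> Rel" for x x' y y'
    using Rel_less[OF that] Rel_less[OF that(2,1)] by (metis linorder_neqE less_irrefl)
  have Domain: "Domain Rel = \<Union>(fst ` K)"
  proof -
    have "Domain Rel = (\<Union>p\<in>K. {Min (fst p), Max (fst p)})" by (force simp: Rel_def)
    also have "\<dots> = (\<Union>p\<in>K. fst p)" by (intro SUP_cong refl sym[OF ends(1)]) (use K(1) in auto)
    finally show ?thesis by simp
  qed
  have Range: "Range Rel = \<Union>(snd ` K)"
  proof -
    have "Range Rel = (\<Union>p\<in>K. {Min (snd p), Max (snd p)})" by (force simp: Rel_def)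
    also have "\<dots> = (\<Union>p\<in>K. snd p)" by (intro SUP_cong refl sym[OF ends(1)]) (use K(1) in auto)
    finally show ?thesis by simp
  qed
  define \<phi> where "\<phi> x = (SOME x'. (x, x') \<in> Rel)" for x
  have \<phi>: "(x, \<phi> x) \<in> Rel" if "x \<in> Domain Rel" for x
    using that unfolding \<phi>_def by (auto intro: someI)
  have \<phi>_eq: "\<phi> x = x'" if "(x, x') \<in> Rel" for x x'
    using Rel_eq[OF that \<phi>] that by auto
  have im: "\<phi> ` Domain Rel = Range Rel"
    using \<phi> \<phi>_eq by (auto intro: image_eqI[OF sym])
  have "finite K" using K(1) M(1) by (auto intro: finite_subset)
  have "finite (\<Union>(fst ` K))"
  proof (rule finite_Union)
    show "finite (fst ` K)" using \<open>finite K\<close> by simp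
    show "finite e" if "e \<in> fst ` K" for e
      using that KM(1) M(2) by (force intro: card_ge_0_finite)
  qed
  then have fin: "finite (Domain Rel)" unfolding Domain .
  have RelI: "(Min e, Min e') \<in> Rel" "(Max e, Max e') \<in> Rel" if "(e, e') \<in> K" for e e'
    using that by (auto simp: Rel_def)
  have Min_Max: "x = Min e" "y = Max e" if "{x, y} = e" "e \<in> M" "x < y" for x y e
    using that by (auto simp: min_def max_def)
  have "order_isomorphic (Domain Rel) (fst ` K) (\<phi> ` Domain Rel) (snd ` K)"
  proof (rule order_isomorphic_strict_mono[OF fin])
    fix x y assume xy: "x \<in> Domain Rel" "y \<in> Domain Rel" "x < y"
    show less: "\<phi> x < \<phi> y"
      using Rel_less[OF \<phi>[OF xy(1)] \<phi>[OF xy(2)]] xy(3) by simp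
    show "{x, y} \<in> fst ` K \<longleftrightarrow> {\<phi> x, \<phi> y} \<in> snd ` K"
    proof
      assume "{x, y} \<in> fst ` K"
      then obtain e e' where e: "(e, e') \<in> K" "{x, y} = e" by force
      then have "x = Min e" "y = Max e" using Min_Max[of x y e] KM[OF e(1)] xy(3) by auto
      then have "{\<phi> x, \<phi> y} = e'" using \<phi>_eq RelI[OF e(1)] ends(1)[OF KM(2)[OF e(1)]] by simp
      then show "{\<phi> x, \<phi> y} \<in> snd ` K" using e(1) by force
    next
      assume "{\<phi> x, \<phi> y} \<in> snd ` K"
      then obtain e e' where e: "(e, e') \<in> K" "{\<phi> x, \<phi> y} = e'" by force
      then have "\<phi> x = Min e'" "\<phi> y = Max e'" using Min_Max[of "\<phi> x" "\<phi> y" e'] KM[OF e(1)] less by auto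
      then have "x = Min e" "y = Max e"
        using Rel_eq[OF \<phi>[OF xy(1)] RelI(1)[OF e(1)]] Rel_eq[OF \<phi>[OF xy(2)] RelI(2)[OF e(1)]] by auto
      then have "{x, y} = e" using ends(1)[OF KM(1)[OF e(1)]] by simp
      then show "{x, y} \<in> fst ` K" using e(1) by force
    qed
  qed
  then have "order_isomorphic (\<Union>(fst ` K)) (fst ` K) (\<Union>(snd ` K)) (snd ` K)"
    unfolding im unfolding Domain Range .
  then have "twins M (fst ` K) (snd ` K)"
    using K(1,3) unfolding twins_def by auto
  \<comment> \<open>Two partners of one edge would have the same lower end and hence coincide, so
    counting pairs is the same as counting edges of one twin.\<close>
  moreover have "inj_on fst K"
  proof (rule inj_onI)
    fix p q assume pq: "p \<in> K" "q \<in> K" "fst p = fst q"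
    obtain e e' d' where e: "p = (e, e')" "q = (e, d')" using pq(3) by (cases p; cases q) auto
    then have K': "(e, e') \<in> K" "(e, d') \<in> K" using pq by auto
    then have "Min e' = Min d'" using Rel_eq RelI(1) by blast
    moreover have "Min e' \<in> e'" "Min d' \<in> d'"
      using ends(1)[OF KM(2)[OF K'(1)]] ends(1)[OF KM(2)[OF K'(2)]] by auto
    ultimately have "e' = d'" using disj KM(2)[OF K'(1)] KM(2)[OF K'(2)] by metis
    then show "p = q" using e by simp
  qed
  ultimately show ?thesis by (simp add: card_image)
qed

theorem corollary19:
  fixes n :: nat
  assumes "n \<ge> 2"
  shows "real (t2_match n) \<ge> 1 / 8 * (real n / 4) powr (3 / 5)"
proof -
  \<comment> \<open>The minimum is attained, so it suffices to bound \<open>t2 M\<close> for one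
    matching \<open>M\<close>.\<close>
  have "t2_match n \<in> {t2 M | M. ordered_matching {1..2 * n} M n}"
    unfolding t2_match_def using t2_values_finite t2_values_nonempty by (rule Min_in)
  then obtain M where t2: "t2_match n = t2 M" and "ordered_matching {1..2 * n} M n"
    by blast
  then have M: "finite M" "card M = n" "pairwise disjnt M" and card2: "\<And>e. e \<in> M \<Longrightarrow> card e = 2"
    by (auto simp: ordered_matching_def)
  have mem: "Min e \<in> e" "Max e \<in> e" "Min e < Max e" if "e \<in> M" for e
    using card_2_Min_Max[OF card2[OF that]] by auto
  \<comment> \<open>Disjoint edges cannot share a lower or an upper endpoint.\<close>
  have inj: "inj_on Min M" "inj_on Max M"
    using mem(1,2) M(3) by (auto intro!: inj_onI simp: pairwise_def disjnt_def) (metis disjoint_iff)+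
  then obtain K where K: "K \<subseteq> M \<times> M" "comonotone {Min, Max} K" "fst ` K \<inter> snd ` K = {}"
    "1 / 8 * (real n / 4) powr (3 / 5) \<le> card K"
    using twins_in_matching[OF M(1) inj mem(3), unfolded M(2), OF _ assms] by blast
  have "twins M (fst ` K) (snd ` K)" and card: "card (fst ` K) = card K"
    using twins_of_comonotone[OF M(1) card2 M(3) K(1-3)] by auto
  then have "card K \<le> t2 M"
    unfolding t2_def using twin_sizes_finite[OF M(1)] by (intro Max_ge) (auto intro: exI[of _ "fst ` K"])
  then show ?thesis
    using K(4) unfolding t2 by linarith
qed

end
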